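(* Let $A$ and $E$ be sets. To give a monad on $A$ in $\mathbf{Mly}$ with carrier $E$, unit element $e_0$, multiplication $\cdot$ and structure maps $d:A\times E\to E$, $s:A\times E\to A$ is the same as to give a monoid structure $(E,\cdot,e_0)$ on $E$ and functions $d:A\times E\to E$, $s:A\times E\to A$ such that, denoting by $\triangleright:A^*\times E\to E$ and $\triangleleft:A^*\times E\to A^*$ the canonical extensions of $d$ and $s$: (i) $\triangleright$ is a left action of the free monoid $A^*$ on the set $E$; (ii) $s$ is a right action of the monoid $E$ on the set $A$, i.e. $s(a,e_0)=a$ and $s(a,e\cdot e')=s(s(a,e),e')$ for all $a\in A$ and $e,e'\in E$; (iii) $e_0$ is a fixpoint of the action $\triangleright$: $as\triangleright e_0=e_0$ for all $as\in A^*$; (iv) the empty list is a fixpoint of $\triangleleft$: $[\,]\triangleleft e=[\,]$ for all $e\in E$; (v) the two bicrossed equations hold for all $as,bs\in A^*$ and $e,e'\in E$: $$as\triangleright(e\cdot e')=(as\triangleright e)\cdot\big((as\triangleleft e)\triangleright e'\big),$$ $$(as\mathbin{+\!\!+}bs)\triangleleft e=\big(as\triangleleft(bs\triangleright e)\big)\mathbin{+\!\!+}(bs\triangleleft e).$$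
   Context: $\mathbf{Mly}$ is the pseudo double category of Mealy automata in the category of sets. Its objects are sets and its tight morphisms are functions. A loose morphism $A\nrightarrow B$ is a triple $(E,d,s)$ with $E$ a set (the carrier) and $d:A\times E\to E$, $s:A\times E\to B$ functions. A cell from $(E,d,s):A\nrightarrow B$ to $(E',d',s'):X\nrightarrow Y$ with tight sides $f:A\to X$, $g:B\to Y$ is a function $\alpha:E\to E'$ with $\alpha(d(a,e))=d'(f(a),\alpha(e))$ and $g(s(a,e))=s'(f(a),\alpha(e))$. The loose identity of $A$ has a singleton as carrier and output map the projection to $A$. The loose composite of $(E,d,s):A\nrightarrow B$ followed by $(F,d',s'):B\nrightarrow C$ has carrier $E\times F$ and maps $(a,(e,x))\mapsto (d(a,e),d'(s(a,e),x))$ and $(a,(e,x))\mapsto s'(s(a,e),x)$. A monad on $A$ in $\mathbf{Mly}$ is a monad in the bicategory of objects, loose morphisms and cells with identity tight sides. Explicitly, it consists of a set $E$ with functions $d:A\times E\to E$ and $s:A\times E\to A$, an element $e_0\in E$ (the unit cell) and a function $\mu:E\times E\to E$, written $e\cdot e'=\mu(e,e')$ (the multiplication cell), such that for all $a\in A$, $e,e'\in E$: (1) $s(a,e_0)=a$; (2) $d(a,e_0)=e_0$; (3) $s(a,e\cdot e')=s(s(a,e),e')$; (4) $d(a,e\cdot e')=d(a,e)\cdot d(s(a,e),e')$; and (5) $(E,\cdot,e_0)$ is a monoid. $A^*$ is the free monoid of finite lists on $A$, with empty list $[\,]$, concatenation $\mathbin{+\!\!+}$ and cons $a::as$. The canonical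 extensions of $d$ and $s$ are defined recursively by $[\,]\triangleright e=e$, $(a::as)\triangleright e=d(a,as\triangleright e)$, and $[\,]\triangleleft e=[\,]$, $(a::as)\triangleleft e=s(a,as\triangleright e)::(as\triangleleft e)$. *)

theory Defs
  imports "HOL-Algebra.Group"
begin

text \<open>
  Sets are modelled as subsets of types, so that the empty set is included, and maps are
  total HOL functions of which only the values on the given sets matter. Accordingly,
  equations between cells are required on the carriers only.
\<close>

record ('a, 'b, 'e) mealy =
  states :: "'e set"
  step :: "'a \<Rightarrow> 'e \<Rightarrow> 'e"
  outp :: "'a \<Rightarrow> 'e \<Rightarrow> 'b"

definition loose :: "'a set \<Rightarrow> 'b set \<Rightarrow> ('a, 'b, 'e) mealy \<Rightarrow> bool" where
  "loose A B P \<longleftrightarrow>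
     step P \<in> A \<rightarrow> states P \<rightarrow> states P \<and> outp P \<in> A \<rightarrow> states P \<rightarrow> B"

text \<open>Cells from \<open>P : A \<rightarrow> B\<close> to \<open>Q : X \<rightarrow> Y\<close> with tight sides \<open>f\<close> and \<open>g\<close>.\<close>

definition cell ::
  "'a set \<Rightarrow> 'b set \<Rightarrow> 'x set \<Rightarrow> 'y set \<Rightarrow> ('a \<Rightarrow> 'x) \<Rightarrow> ('b \<Rightarrow> 'y) \<Rightarrow>
   ('a, 'b, 'e) mealy \<Rightarrow> ('x, 'y, 'f) mealy \<Rightarrow> ('e \<Rightarrow> 'f) \<Rightarrow> bool" where
  "cell A B X Y f g P Q \<alpha> \<longleftrightarrow>
     loose A B P \<and> loose X Y Q \<and> f \<in> A \<rightarrow> X \<and> g \<in> B \<rightarrow> Y \<and> \<alpha> \<in> states P \<rightarrow> states Q \<and>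
     (\<forall>a\<in>A. \<forall>e\<in>states P.
        \<alpha> (step P a e) = step Q (f a) (\<alpha> e) \<and> g (outp P a e) = outp Q (f a) (\<alpha> e))"

text \<open>Cells with identity tight sides, i.e. the 2-cells of the bicategory.\<close>

abbreviation globular_cell ::
  "'a set \<Rightarrow> 'b set \<Rightarrow> ('a, 'b, 'e) mealy \<Rightarrow> ('a, 'b, 'f) mealy \<Rightarrow> ('e \<Rightarrow> 'f) \<Rightarrow> bool" where
  "globular_cell A B \<equiv> cell A B A B id id"

definition loose_id :: "('a, 'a, unit) mealy" where
  "loose_id = \<lparr>states = {()}, step = (\<lambda>a u. u), outp = (\<lambda>a u. a)\<rparr>"

definition loose_comp ::
  "('a, 'b, 'e) mealy \<Rightarrow> ('b, 'c, 'f) mealy \<Rightarrow> ('a, 'c, 'e \<times> 'f) mealy" where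
  "loose_comp P Q =
     \<lparr>states = states P \<times> states Q,
      step = (\<lambda>a (e, x). (step P a e, step Q (outp P a e) x)),
      outp = (\<lambda>a (e, x). outp Q (outp P a e) x)\<rparr>"

text \<open>
  On underlying functions, horizontal composition of cells is \<^const>\<open>map_prod\<close>; the coherence
  cells are the canonical bijections. The lemmas below confirm that these are cells.
\<close>

definition left_unitor :: "unit \<times> 'e \<Rightarrow> 'e" where
  "left_unitor = (\<lambda>(u, e). e)"

definition right_unitor :: "'e \<times> unit \<Rightarrow> 'e" where
  "right_unitor = (\<lambda>(e, u). e)"

definition associator :: "('e \<times> 'f) \<times> 'g \<Rightarrow> 'e \<times> ('f \<times> 'g)" where
  "associator = (\<lambda>((e, x), y). (e, (x, y)))"

lemma loose_loose_id: "loose A A loose_id"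
  by (auto simp: loose_def loose_id_def)

lemma loose_loose_comp: "loose A B P \<Longrightarrow> loose B C Q \<Longrightarrow> loose A C (loose_comp P Q)"
  by (auto simp: loose_def loose_comp_def Pi_iff)

lemma cell_map_prod:
  assumes "cell A B X Y f g P P' \<alpha>" and "cell B C Y Z g h Q Q' \<beta>"
  shows "cell A C X Z f h (loose_comp P Q) (loose_comp P' Q') (map_prod \<alpha> \<beta>)"
  using assms by (auto simp: cell_def loose_def loose_comp_def Pi_iff)

lemma cell_left_unitor:
  "loose A B P \<Longrightarrow> globular_cell A B (loose_comp loose_id P) P left_unitor"
  by (auto simp: cell_def loose_def loose_comp_def loose_id_def left_unitor_def Pi_iff)

lemma cell_right_unitor:
  "loose A B P \<Longrightarrow> globular_cell A B (loose_comp P loose_id) P right_unitor"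
  by (auto simp: cell_def loose_def loose_comp_def loose_id_def right_unitor_def Pi_iff)

lemma cell_associator:
  assumes "loose A B P" and "loose B C Q" and "loose C D R"
  shows "globular_cell A D (loose_comp (loose_comp P Q) R) (loose_comp P (loose_comp Q R))
           associator"
  using assms by (auto simp: cell_def loose_def loose_comp_def associator_def Pi_iff)

text \<open>Monads on \<open>A\<close> in the bicategory, with unit cell \<open>\<eta>\<close> and multiplication cell \<open>\<mu>\<close>.\<close>

definition mly_monad ::
  "'a set \<Rightarrow> ('a, 'a, 'e) mealy \<Rightarrow> (unit \<Rightarrow> 'e) \<Rightarrow> ('e \<times> 'e \<Rightarrow> 'e) \<Rightarrow> bool" where
  "mly_monad A T \<eta> \<mu> \<longleftrightarrow>
     loose A A T \<and>
     globular_cell A A loose_id T \<eta> \<and>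
     globular_cell A A (loose_comp T T) T \<mu> \<and>
     (\<forall>p\<in>states (loose_comp loose_id T). (\<mu> \<circ> map_prod \<eta> id) p = left_unitor p) \<and>
     (\<forall>p\<in>states (loose_comp T loose_id). (\<mu> \<circ> map_prod id \<eta>) p = right_unitor p) \<and>
     (\<forall>p\<in>states (loose_comp (loose_comp T T) T).
        (\<mu> \<circ> map_prod \<mu> id) p = (\<mu> \<circ> map_prod id \<mu> \<circ> associator) p)"

lemma mly_monad_explicit:
  "mly_monad A \<lparr>states = E, step = d, outp = s\<rparr> (\<lambda>_. e0) (\<lambda>(e, e'). m e e') \<longleftrightarrow>
     d \<in> A \<rightarrow> E \<rightarrow> E \<and> s \<in> A \<rightarrow> E \<rightarrow> A \<and>
     (\<forall>a\<in>A. s a e0 = a) \<and>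
     (\<forall>a\<in>A. d a e0 = e0) \<and>
     (\<forall>a\<in>A. \<forall>e\<in>E. \<forall>e'\<in>E. s a (m e e') = s (s a e) e') \<and>
     (\<forall>a\<in>A. \<forall>e\<in>E. \<forall>e'\<in>E. d a (m e e') = m (d a e) (d (s a e) e')) \<and>
     monoid \<lparr>carrier = E, mult = m, one = e0\<rparr>"
  unfolding mly_monad_def cell_def loose_def loose_comp_def loose_id_def left_unitor_def
    right_unitor_def associator_def monoid_def
  apply (simp add: Pi_iff)
  apply (rule iffI)
   apply auto
  done

locale left_monoid_action = monoid M for M (structure) +
  fixes X :: "'x set" and act :: "'m \<Rightarrow> 'x \<Rightarrow> 'x"
  assumes act_closed: "act \<in> carrier M \<rightarrow> X \<rightarrow> X"
    and act_one: "x \<in> X \<Longrightarrow> act \<one> x = x"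
    and act_mult: "g \<in> carrier M \<Longrightarrow> h \<in> carrier M \<Longrightarrow> x \<in> X \<Longrightarrow> act (g \<otimes> h) x = act g (act h x)"

locale right_monoid_action = monoid M for M (structure) +
  fixes X :: "'x set" and act :: "'x \<Rightarrow> 'm \<Rightarrow> 'x"
  assumes act_closed: "act \<in> X \<rightarrow> carrier M \<rightarrow> X"
    and act_one: "x \<in> X \<Longrightarrow> act x \<one> = x"
    and act_mult: "g \<in> carrier M \<Longrightarrow> h \<in> carrier M \<Longrightarrow> x \<in> X \<Longrightarrow> act x (g \<otimes> h) = act (act x g) h"

definition free_monoid :: "'a set \<Rightarrow> 'a list monoid" where
  "free_monoid A = \<lparr>carrier = lists A, mult = (@), one = []\<rparr>"

text \<open>The canonical extensions of \<open>d\<close> and \<open>s\<close> to lists; the last letter acts first.\<close>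

primrec step_ext :: "'a list \<Rightarrow> ('a \<Rightarrow> 'e \<Rightarrow> 'e) \<Rightarrow> 'e \<Rightarrow> 'e"
    ("(_ \<triangleright>\<^bsub>_\<^esub> _)" [76, 0, 76] 75) where
  "[] \<triangleright>\<^bsub>d\<^esub> e = e"
| "(a # as) \<triangleright>\<^bsub>d\<^esub> e = d a (as \<triangleright>\<^bsub>d\<^esub> e)"

primrec outp_ext :: "'a list \<Rightarrow> ('a \<Rightarrow> 'e \<Rightarrow> 'e) \<Rightarrow> ('a \<Rightarrow> 'e \<Rightarrow> 'b) \<Rightarrow> 'e \<Rightarrow> 'b list"
    ("(_ \<triangleleft>\<^bsub>_,_\<^esub> _)" [76, 0, 0, 76] 75) where
  "[] \<triangleleft>\<^bsub>d,s\<^esub> e = []"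
| "(a # as) \<triangleleft>\<^bsub>d,s\<^esub> e = s a (as \<triangleright>\<^bsub>d\<^esub> e) # (as \<triangleleft>\<^bsub>d,s\<^esub> e)"

end

theory Submission
  imports Defs
begin

text \<open>By \<open>mly_monad_explicit\<close> a monad is a monoid with four equations on
  \<open>d\<close> and \<open>s\<close>. The two equations for \<open>s\<close> say that
  \<open>s\<close> is a right action. The list action law and the formula for \<triangleleft> on a
  concatenation come from the recursion defining the extensions (\<open>step_ext_append\<close>,
  \<open>outp_ext_append\<close>). The two equations for \<open>d\<close> are the one-letter cases
  of the fixpoint condition on \<open>e0\<close> and of the first bicrossed equation;
  \<open>step_ext_fixpoint\<close> and \<open>step_ext_mult\<close> pass from letters to lists.
  Conversely, \<open>[a]\<close> \<triangleright> \<open>e\<close> is \<open>d a e\<close> and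
  \<open>[a]\<close> \<triangleleft> \<open>e\<close> is \<open>[s a e]\<close>, so singletons
  return the letter equations.\<close>

text \<open>
  Both extensions are determined by their values on single letters. So the conditions on
  lists follow from the monad equations by induction, and give them back on singletons.
\<close>

lemma step_ext_append: "(as @ bs) \<triangleright>\<^bsub>d\<^esub> e = as \<triangleright>\<^bsub>d\<^esub> (bs \<triangleright>\<^bsub>d\<^esub> e)"
  by (induction as) simp_all

text \<open>Each letter of \<open>as\<close> is read in the state reached after all letters to its
  right, hence after the whole of \<open>bs\<close>; this is why \<open>as\<close> meets
  \<open>bs\<close> \<triangleright> \<open>e\<close> and not \<open>e\<close>.\<close>

lemma outp_ext_append:
  "(as @ bs) \<triangleleft>\<^bsub>d,s\<^esub> e = (as \<triangleleft>\<^bsub>d,s\<^esub> (bs \<triangleright>\<^bsub>d\<^esub> e)) @ (bs \<triangleleft>\<^bsub>d,s\<^esub> e)"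
  by (induction as) (simp_all add: step_ext_append)

lemma step_ext_closed:
  assumes "d \<in> A \<rightarrow> E \<rightarrow> E" and "as \<in> lists A" and "e \<in> E"
  shows "as \<triangleright>\<^bsub>d\<^esub> e \<in> E"
  using assms(2) by induction (use assms(1,3) in \<open>auto simp: Pi_iff\<close>)

lemma outp_ext_closed:
  assumes "d \<in> A \<rightarrow> E \<rightarrow> E" and "s \<in> A \<rightarrow> E \<rightarrow> B" and "as \<in> lists A" and "e \<in> E"
  shows "as \<triangleleft>\<^bsub>d,s\<^esub> e \<in> lists B"
  using assms(3) by induction (use assms(1,2,4) in \<open>auto simp: Pi_iff step_ext_closed\<close>)

lemma step_ext_fixpoint:
  assumes "\<And>a. a \<in> A \<Longrightarrow> d a e = e" and "as \<in> lists A"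
  shows "as \<triangleright>\<^bsub>d\<^esub> e = e"
  using assms(2) by induction (simp_all add: assms(1))

lemma step_ext_mult:
  assumes d: "d \<in> A \<rightarrow> E \<rightarrow> E" and s: "s \<in> A \<rightarrow> E \<rightarrow> A"
    and d_mult: "\<And>a e e'. a \<in> A \<Longrightarrow> e \<in> E \<Longrightarrow> e' \<in> E \<Longrightarrow> d a (m e e') = m (d a e) (d (s a e) e')"
    and as: "as \<in> lists A" and e: "e \<in> E" "e' \<in> E"
  shows "as \<triangleright>\<^bsub>d\<^esub> (m e e') = m (as \<triangleright>\<^bsub>d\<^esub> e) ((as \<triangleleft>\<^bsub>d,s\<^esub> e) \<triangleright>\<^bsub>d\<^esub> e')"
  using as
proof induction
  case Nil
  show ?case by simp
next
  case (Cons a as)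
  \<comment> \<open>After the induction hypothesis, \<open>d_mult\<close> splits \<open>d a\<close>
    over the product of \<open>as\<close> \<triangleright> \<open>e\<close> and (\<open>as\<close>
    \<triangleleft> \<open>e\<close>) \<triangleright> \<open>e'\<close>. The letter
    \<open>s a\<close> (\<open>as\<close> \<triangleright> \<open>e\<close>) that then acts on the
    second factor is the head of \<open>(a # as)\<close> \<triangleleft> \<open>e\<close>. The
    closure lemmas place both factors in \<open>E\<close>, where \<open>d_mult\<close>
    applies.\<close>
  then show ?case
    using d_mult step_ext_closed[OF d] outp_ext_closed[OF d s] e by simp
qed

lemma monoid_free_monoid: "monoid (free_monoid A)"
  by unfold_locales (auto simp: free_monoid_def)

text \<open>Since \<open>A\<close>-lists form the free monoid, any map \<open>d\<close> of the right
  type generates an action; the law for products is \<open>step_ext_append\<close>.\<close>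

lemma left_monoid_action_step_ext:
  assumes "d \<in> A \<rightarrow> E \<rightarrow> E"
  shows "left_monoid_action (free_monoid A) E (\<lambda>as e. as \<triangleright>\<^bsub>d\<^esub> e)"
  by (intro left_monoid_action.intro left_monoid_action_axioms.intro monoid_free_monoid)
    (auto simp: free_monoid_def step_ext_append step_ext_closed[OF assms])

theorem corollary11:
  fixes A :: "'a set" and E :: "'e set"
    and d :: "'a \<Rightarrow> 'e \<Rightarrow> 'e" and s :: "'a \<Rightarrow> 'e \<Rightarrow> 'a"
    and e0 :: 'e and m :: "'e \<Rightarrow> 'e \<Rightarrow> 'e"
  shows "mly_monad A \<lparr>states = E, step = d, outp = s\<rparr> (\<lambda>_. e0) (\<lambda>(e, e'). m e e') \<longleftrightarrow>
    monoid \<lparr>carrier = E, mult = m, one = e0\<rparr> \<and>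
    d \<in> A \<rightarrow> E \<rightarrow> E \<and>
    s \<in> A \<rightarrow> E \<rightarrow> A \<and>
    left_monoid_action (free_monoid A) E (\<lambda>as e. as \<triangleright>\<^bsub>d\<^esub> e) \<and>
    right_monoid_action \<lparr>carrier = E, mult = m, one = e0\<rparr> A s \<and>
    (\<forall>as\<in>lists A. as \<triangleright>\<^bsub>d\<^esub> e0 = e0) \<and>
    (\<forall>e\<in>E. [] \<triangleleft>\<^bsub>d,s\<^esub> e = []) \<and>
    (\<forall>as\<in>lists A. \<forall>e\<in>E. \<forall>e'\<in>E.
       as \<triangleright>\<^bsub>d\<^esub> (m e e') = m (as \<triangleright>\<^bsub>d\<^esub> e) ((as \<triangleleft>\<^bsub>d,s\<^esub> e) \<triangleright>\<^bsub>d\<^esub> e')) \<and>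
    (\<forall>as\<in>lists A. \<forall>bs\<in>lists A. \<forall>e\<in>E.
       (as @ bs) \<triangleleft>\<^bsub>d,s\<^esub> e = (as \<triangleleft>\<^bsub>d,s\<^esub> (bs \<triangleright>\<^bsub>d\<^esub> e)) @ (bs \<triangleleft>\<^bsub>d,s\<^esub> e))"
    (is "?monad \<longleftrightarrow> ?bicrossed")
proof
  assume ?monad
  then have d: "d \<in> A \<rightarrow> E \<rightarrow> E" and s: "s \<in> A \<rightarrow> E \<rightarrow> A"
    and s_one: "\<And>a. a \<in> A \<Longrightarrow> s a e0 = a"
    and d_one: "\<And>a. a \<in> A \<Longrightarrow> d a e0 = e0"
    and s_mult: "\<And>a e e'. a \<in> A \<Longrightarrow> e \<in> E \<Longrightarrow> e' \<in> E \<Longrightarrow> s a (m e e') = s (s a e) e'"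
    and d_mult: "\<And>a e e'. a \<in> A \<Longrightarrow> e \<in> E \<Longrightarrow> e' \<in> E \<Longrightarrow> d a (m e e') = m (d a e) (d (s a e) e')"
    and M: "monoid \<lparr>carrier = E, mult = m, one = e0\<rparr>"
    unfolding mly_monad_explicit by blast+
  have "right_monoid_action \<lparr>carrier = E, mult = m, one = e0\<rparr> A s"
    using M s s_one s_mult
    by (auto intro!: right_monoid_action.intro right_monoid_action_axioms.intro simp: Pi_iff)
  then show ?bicrossed
    using M d s left_monoid_action_step_ext[OF d] step_ext_fixpoint[of A d e0] d_one
      step_ext_mult[of d A E s m] d_mult outp_ext_append[of _ _ d s]
    by simp
next
  assume bicrossed: ?bicrossed
  \<comment> \<open>The interpretation supplies both monad equations for \<open>s\<close>, as
    \<open>act_one\<close> and \<open>act_mult\<close>.\<close>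
  then interpret right_monoid_action "\<lparr>carrier = E, mult = m, one = e0\<rparr>" A s
    by blast
  \<comment> \<open>The fixpoint condition is read at the list \<open>[a]\<close>.\<close>
  have d_one: "d a e0 = e0" if "a \<in> A" for a
    using bicrossed that by (force dest: bspec[of _ _ "[a]"])
  have d_mult: "d a (m e e') = m (d a e) (d (s a e) e')" if "a \<in> A" "e \<in> E" "e' \<in> E" for a e e'
  proof -
    \<comment> \<open>In the first bicrossed equation at \<open>[a]\<close>, the list acting on
      \<open>e'\<close> evaluates to \<open>[s a e]\<close>.\<close>
    have "[a] \<triangleright>\<^bsub>d\<^esub> (m e e') = m ([a] \<triangleright>\<^bsub>d\<^esub> e) (([a] \<triangleleft>\<^bsub>d,s\<^esub> e) \<triangleright>\<^bsub>d\<^esub> e')"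
      using bicrossed that by (metis lists.Cons lists.Nil)
    then show ?thesis by simp
  qed
  show ?monad
    unfolding mly_monad_explicit using bicrossed d_one d_mult act_one act_mult by simp
qed

end
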